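(* Let $I\subset[X]$ be a monoid ideal, let $W=W(I)$ be its minimal set of generators, and let $L_I$ be the lattice of all least common multiples of finite subsets of $W$, ordered by divisibility. Let $\hat0$ denote the minimal element of $L_I$, and for $m\in L_I$ let $\mu(\hat0,m)$ be the value of the Möbius function of the poset $L_I$ on the interval $[\hat0,m]$. Let $\Delta(\hat0,m)$ be the abstract simplicial complex of all chains in the open interval $(\hat0,m)$. Then for all $m\in[X]$ the coefficient $[m]p(I)$ of $m$ in $p(I)$ is $$[m]p(I)=\begin{cases}0 & m\notin L_I,\\ \tilde\chi(\Delta(\hat0,m))=\mu(\hat0,m)& m\in L_I.\end{cases}$$
   Context: $X=\{x_1,x_2,\dots\}$ is a countable set of indeterminates; $[X]$ is the free abelian monoid of monomials in $X$. A monoid ideal is a subset $I\subset[X]$ with $[X]I\subset I$; $W(I)=I\setminus([X]\setminus\{1\})I$. $\mathbb{Z}[[X]]$ is the ring of all formal sums $\sum_{m\in[X]}c_m m$, $c_m\in\mathbb{Z}$, with convolution product, and $p(I)=\prod_{i\ge1}(1-x_i)\cdot\sum_{m\in[X]\setminus I}m$. The least common multiple of the empty set is $1$. $\tilde\chi$ is the reduced Euler characteristic of an abstract simplicial complex, counting the empty set as a face of dimension $-1$.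
   Formalization: At m = 1 the equality with the reduced Euler characteristic is dropped, since it is −1 while μ = 1; for I = [X] the coefficient at m = 1 is also excluded, since p(I) = 0 but μ = 1. *)

theory Defs
  imports Complex_Main "HOL-Library.Multiset"
begin

text \<open>
  The free abelian monoid \<open>[X]\<close> on \<open>X = {x_1, x_2, ...}\<close> is \<^typ>\<open>nat multiset\<close>, with \<open>n\<close> standing
  for the indeterminate \<open>x_(n+1)\<close>. The monoid operation is \<open>+\<close>, the monomial \<open>1\<close> is \<open>{#}\<close>,
  divisibility is \<open>\<subseteq>#\<close> and the least common multiple is the supremum with respect to \<open>\<subseteq>#\<close>.
\<close>

type_synonym monom = "nat multiset"


section \<open>Monoid ideals and the lattice of least common multiples\<close>

definition monoid_ideal :: "monom set \<Rightarrow> bool" where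
  "monoid_ideal I \<longleftrightarrow> (\<forall>a. \<forall>n\<in>I. a + n \<in> I)"

definition min_gens :: "monom set \<Rightarrow> monom set" where
  "min_gens I = I - {a + n | a n. a \<noteq> {#} \<and> n \<in> I}"

text \<open>By \<open>Sup_multiset_empty\<close>, the least common multiple of the empty set is \<open>{#}\<close>.\<close>

definition lcm_lattice :: "monom set \<Rightarrow> monom set" where
  "lcm_lattice I = {Sup F | F. finite F \<and> F \<subseteq> min_gens I}"

lemma Sup_finite_least_common_multiple:
  fixes F :: "monom set"
  assumes "finite F"
  shows "w \<in> F \<Longrightarrow> w \<subseteq># Sup F" and "(\<And>w. w \<in> F \<Longrightarrow> w \<subseteq># n) \<Longrightarrow> Sup F \<subseteq># n"
proof -
  have bdd: "subset_mset.bdd_above F"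
    using assms by simp
  show "w \<in> F \<Longrightarrow> w \<subseteq># Sup F"
    using bdd by (rule subset_mset.cSup_upper[rotated])
  show "(\<And>w. w \<in> F \<Longrightarrow> w \<subseteq># n) \<Longrightarrow> Sup F \<subseteq># n"
    by (cases "F = {}") (auto simp: Sup_multiset_empty intro: subset_mset.cSup_least)
qed

lemma lcm_lattice_least:
  shows "{#} \<in> lcm_lattice I" and "m \<in> lcm_lattice I \<Longrightarrow> {#} \<subseteq># m"
  by (auto simp: lcm_lattice_def Sup_multiset_empty intro: exI[of _ "{}"])


section \<open>Moebius function, order complex, reduced Euler characteristic\<close>

text \<open>
  The Moebius function of a set \<open>P\<close> of multisets ordered by divisibility. Every such poset is
  locally finite, because a multiset has only finitely many divisors.
\<close>

function moebius :: "'a multiset set \<Rightarrow> 'a multiset \<Rightarrow> 'a multiset \<Rightarrow> int" where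
  "moebius P a b =
     (if a = b then 1
      else if a \<subset># b then - (\<Sum>c\<in>{c\<in>P. a \<subseteq># c \<and> c \<subset># b}. moebius P a c)
      else 0)"
  by auto
termination
  by (relation "measure (\<lambda>(P, a, b). size b)") (auto intro: mset_subset_size)

declare moebius.simps [simp del]

definition open_interval :: "'a multiset set \<Rightarrow> 'a multiset \<Rightarrow> 'a multiset \<Rightarrow> 'a multiset set" where
  "open_interval P a b = {c\<in>P. a \<subset># c \<and> c \<subset># b}"

definition order_complex :: "'a multiset set \<Rightarrow> 'a multiset \<Rightarrow> 'a multiset \<Rightarrow> 'a multiset set set" where
  "order_complex P a b =
     {C. C \<subseteq> open_interval P a b \<and> (\<forall>x\<in>C. \<forall>y\<in>C. x \<subseteq># y \<or> y \<subseteq># x)}"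

text \<open>A face \<open>F\<close> has dimension \<open>card F - 1\<close>, of the same parity as \<open>card F + 1\<close>.\<close>

definition reduced_euler_char :: "'a set set \<Rightarrow> int" where
  "reduced_euler_char K = (\<Sum>F\<in>K. (-1) ^ (card F + 1))"

text \<open>
  For \<open>a = b\<close> the open interval is empty, its order complex is \<open>{{}}\<close>, and the two invariants differ.
  The identity between them therefore only concerns intervals with \<open>a \<noteq> b\<close>.
\<close>

lemma reduced_euler_char_trivial_interval: "reduced_euler_char (order_complex P a a) = -1"
proof -
  have "open_interval P a a = {}"
    by (auto simp: open_interval_def)
  hence "order_complex P a a = {{}}"
    by (auto simp: order_complex_def)
  thus ?thesis
    by (simp add: reduced_euler_char_def)
qed

lemma moebius_trivial_interval: "moebius P a a = 1"
  by (simp add: moebius.simps)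


section \<open>The ring of formal sums of monomials\<close>

typedef mseries = "UNIV :: (monom \<Rightarrow> int) set"
  morphisms coeff Abs_mseries ..

setup_lifting type_definition_mseries

lemma mseries_eqI: "(\<And>m. coeff f m = coeff g m) \<Longrightarrow> f = g"
  by transfer auto

lemma finite_submultisets: "finite {a. a \<subseteq># m}"
proof (induction m)
  case (add x m)
  let ?S = "{a. a \<subseteq># m}"
  have "a \<in> ?S \<union> add_mset x ` ?S" if "a \<subseteq># add_mset x m" for a
  proof (cases "x \<in># a")
    case True
    then obtain b where "a = add_mset x b"
      by (auto dest: multi_member_split)
    with that show ?thesis by auto
  next
    case False
    with that have "a \<subseteq># m"
      by (metis diff_single_trivial subset_eq_diff_conv add_mset_add_single)
    thus ?thesis by auto
  qed
  hence "{a. a \<subseteq># add_mset x m} \<subseteq> ?S \<union> add_mset x ` ?S" by auto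
  with add.IH show ?case
    by (meson finite_UnI finite_imageI finite_subset)
qed auto

lemma finite_factorizations: "finite {(a, b). a + b = (m :: 'a multiset)}"
proof (rule finite_subset)
  show "{(a, b). a + b = m} \<subseteq> {a. a \<subseteq># m} \<times> {a. a \<subseteq># m}"
    by auto
qed (simp add: finite_submultisets)

instantiation mseries :: comm_ring_1
begin

lift_definition zero_mseries :: mseries is "\<lambda>_. 0" .
lift_definition one_mseries :: mseries is "\<lambda>m. if m = {#} then 1 else 0" .
lift_definition plus_mseries :: "mseries \<Rightarrow> mseries \<Rightarrow> mseries" is "\<lambda>f g m. f m + g m" .
lift_definition minus_mseries :: "mseries \<Rightarrow> mseries \<Rightarrow> mseries" is "\<lambda>f g m. f m - g m" .
lift_definition uminus_mseries :: "mseries \<Rightarrow> mseries" is "\<lambda>f m. - f m" .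
lift_definition times_mseries :: "mseries \<Rightarrow> mseries \<Rightarrow> mseries" is
  "\<lambda>f g m. \<Sum>(a, b)\<in>{(a, b). a + b = m}. f a * g b" .

instance
proof
  fix f g h :: mseries
  show "f * g * h = f * (g * h)"
  proof (transfer, rule ext)
    fix f g h :: "monom \<Rightarrow> int" and m
    let ?D = "\<lambda>m. {(a, b). a + b = (m :: monom)}"
    have "(\<Sum>(d, c)\<in>?D m. (\<Sum>(a, b)\<in>?D d. f a * g b) * h c)
            = (\<Sum>p\<in>?D m. \<Sum>q\<in>?D (fst p). f (fst q) * g (snd q) * h (snd p))"
      by (simp add: sum_distrib_right case_prod_unfold)
    also have "\<dots> = (\<Sum>(p, q)\<in>(SIGMA p:?D m. ?D (fst p)). f (fst q) * g (snd q) * h (snd p))"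
      by (rule sum.Sigma) (auto simp: finite_factorizations)
    also have "\<dots> = (\<Sum>(p, q)\<in>(SIGMA p:?D m. ?D (snd p)). f (fst p) * (g (fst q) * h (snd q)))"
      by (rule sum.reindex_bij_witness[where
            i = "\<lambda>((a, d), (b, c)). ((a + b, c), (a, b))" and
            j = "\<lambda>((d, c), (a, b)). ((a, b + c), (b, c))"])
         (auto simp: algebra_simps)
    also have "\<dots> = (\<Sum>p\<in>?D m. \<Sum>q\<in>?D (snd p). f (fst p) * (g (fst q) * h (snd q)))"
      by (rule sum.Sigma[symmetric]) (auto simp: finite_factorizations)
    also have "\<dots> = (\<Sum>(a, d)\<in>?D m. f a * (\<Sum>(b, c)\<in>?D d. g b * h c))"
      by (simp add: sum_distrib_left case_prod_unfold)
    finally show "(\<Sum>(d, c)\<in>?D m. (\<Sum>(a, b)\<in>?D d. f a * g b) * h c)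
                    = (\<Sum>(a, d)\<in>?D m. f a * (\<Sum>(b, c)\<in>?D d. g b * h c))" .
  qed
  show "f * g = g * f"
  proof (transfer, rule ext)
    fix f g :: "monom \<Rightarrow> int" and m
    show "(\<Sum>(a, b)\<in>{(a, b). a + b = m}. f a * g b) = (\<Sum>(a, b)\<in>{(a, b). a + b = m}. g a * f b)"
      by (rule sum.reindex_bij_witness[where i = prod.swap and j = prod.swap])
         (auto simp: algebra_simps)
  qed
  show "1 * f = f"
  proof (transfer, rule ext)
    fix f :: "monom \<Rightarrow> int" and m
    have "(\<Sum>(a, b)\<in>{(a, b). a + b = m}. (if a = {#} then 1 else 0) * f b)
            = (\<Sum>(a, b)\<in>{({#} :: monom, m)}. (if a = {#} then 1 else 0) * f b)"
      by (rule sum.mono_neutral_right) (auto simp: finite_factorizations split: if_splits)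
    thus "(\<Sum>(a, b)\<in>{(a, b). a + b = m}. (if a = {#} then 1 else 0) * f b) = f m"
      by simp
  qed
  show "(f + g) * h = f * h + g * h"
    by transfer (simp add: ring_distribs case_prod_unfold sum.distrib fun_eq_iff)
  show "(0 :: mseries) \<noteq> 1"
    by transfer (auto simp: fun_eq_iff)
qed (transfer; simp add: fun_eq_iff)+

end

lift_definition monomial :: "monom \<Rightarrow> mseries" is "\<lambda>n m. if m = n then 1 else 0" .

abbreviation var :: "nat \<Rightarrow> mseries" where
  "var i \<equiv> monomial {#i#}"

lift_definition sum_of_monoms :: "monom set \<Rightarrow> mseries" is "\<lambda>S m. if m \<in> S then 1 else 0" .

text \<open>
  The infinite product of a sequence of formal sums is the coefficientwise limit of the partial
  products. As \<^typ>\<open>int\<close> is discrete, a coefficient converges iff it is eventually constant.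
\<close>

lift_definition infinite_prod :: "(nat \<Rightarrow> mseries) \<Rightarrow> mseries" is
  "\<lambda>f m. lim (\<lambda>n. coeff (\<Prod>i<n. f i) m)" .

definition p_series :: "monom set \<Rightarrow> mseries" where
  "p_series I = infinite_prod (\<lambda>i. 1 - var i) * sum_of_monoms (- I)"

lemma coeff_mult_monomial:
  "coeff (f * monomial n) m = (if n \<subseteq># m then coeff f (m - n) else 0)"
proof -
  have "coeff (f * monomial n) m
          = (\<Sum>(a, b)\<in>{(a, b). a + b = m}. coeff f a * (if b = n then 1 else 0))"
    by (simp add: times_mseries.rep_eq monomial.rep_eq)
  also have "\<dots> = (\<Sum>(a, b)\<in>(if n \<subseteq># m then {(m - n, n)} else {}).
                       coeff f a * (if b = n then 1 else 0))"
    by (rule sum.mono_neutral_right) (auto simp: finite_factorizations split: if_splits)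
  finally show ?thesis by simp
qed

lemma convergent_coeff_prod_one_minus_var:
  "convergent (\<lambda>n. coeff (\<Prod>i<n. 1 - var i) m)"
proof -
  obtain N where N: "\<And>i. i \<in># m \<Longrightarrow> i < N"
    using finite_nat_set_iff_bounded[of "set_mset m"] by auto
  have "coeff (\<Prod>i<N + k. 1 - var i) m = coeff (\<Prod>i<N. 1 - var i) m" for k
  proof (induction k)
    case (Suc k)
    have "N + k \<notin># m"
      using N by force
    hence "coeff ((\<Prod>i<N + k. 1 - var i) * var (N + k)) m = 0"
      by (simp add: coeff_mult_monomial)
    with Suc show ?case
      by (simp add: right_diff_distrib minus_mseries.rep_eq)
  qed auto
  hence "(\<lambda>k. coeff (\<Prod>i<k + N. 1 - var i) m) \<longlonglongrightarrow> coeff (\<Prod>i<N. 1 - var i) m"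
    by (simp add: add.commute)
  hence "(\<lambda>n. coeff (\<Prod>i<n. 1 - var i) m) \<longlonglongrightarrow> coeff (\<Prod>i<N. 1 - var i) m"
    by (rule LIMSEQ_offset)
  thus ?thesis
    by (rule convergentI)
qed

text \<open>For the improper ideal, whose lattice is \<open>{{#}}\<close>, the series \<open>p\<close> vanishes identically.\<close>

lemma p_series_UNIV: "p_series UNIV = 0"
proof -
  have "sum_of_monoms (- UNIV) = 0"
    by transfer simp
  thus ?thesis
    by (simp add: p_series_def)
qed

end

theory Submission
  imports Defs
begin

text \<open>
  Let \<open>\<zeta> = sum_of_monoms UNIV\<close> be the sum of all monomials. Multiplication by \<open>\<zeta>\<close> sums coefficients
  over divisors, and \<open>\<zeta>\<close> is inverse to the product of all \<open>1 - x_i\<close>, the geometric series in each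
  variable (\<open>zeta_mult_infinite_prod\<close>). So \<open>p_series I\<close> is the only series \<open>f\<close> for which
  \<open>\<zeta> * f\<close> is the sum of the monomials outside \<open>I\<close>.

  The series whose coefficients are \<open>\<mu> {#} d\<close> for \<open>d\<close> in the lcm lattice and \<open>0\<close> elsewhere has this
  property. The divisors of \<open>m\<close> that belong to the lattice have a greatest one, \<open>r\<close>: the least common
  multiple of the minimal generators dividing \<open>m\<close> (\<open>lcm_lattice_greatest_divisor\<close>). So the divisor sum
  at \<open>m\<close> is the sum of the Moebius function over the whole interval from \<open>{#}\<close> to \<open>r\<close>, which is \<open>1\<close> if
  \<open>r = {#}\<close> and \<open>0\<close> otherwise. For a proper ideal, \<open>r = {#}\<close> says that no generator divides \<open>m\<close>,
  in other words that \<open>m\<close> lies outside \<open>I\<close>.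

  The equality with the reduced Euler characteristic is Philip Hall's theorem
  (\<open>philip_hall\<close>): sorting the chains of an open interval by their greatest element gives the
  recursion that defines the Moebius function.
\<close>

section \<open>The series of all monomials and its inverse\<close>

lemma coeff_zeta_mult:
  "coeff (sum_of_monoms UNIV * f) m = (\<Sum>d\<in>{d. d \<subseteq># m}. coeff f d)"
proof -
  have "coeff (sum_of_monoms UNIV * f) m = (\<Sum>(a, b)\<in>{(a, b). a + b = m}. coeff f b)"
    by (simp add: times_mseries.rep_eq sum_of_monoms.rep_eq)
  also have "\<dots> = (\<Sum>d\<in>{d. d \<subseteq># m}. coeff f d)"
    by (rule sum.reindex_bij_witness[where i = "\<lambda>d. (m - d, d)" and j = snd]) auto
  finally show ?thesis .
qed

text \<open>
  Multiplication by \<open>var n\<close> maps the monomials in the variables from \<open>n\<close> on bijectively to those among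
  them that involve \<open>n\<close>, so the factor \<open>1 - var n\<close> cancels exactly the latter.
\<close>

lemma zeta_mult_finite_prod:
  "sum_of_monoms UNIV * (\<Prod>i<n. 1 - var i) = sum_of_monoms {m. \<forall>i\<in>#m. n \<le> i}"
proof (induction n)
  case (Suc n)
  have "sum_of_monoms {m. \<forall>i\<in>#m. n \<le> i} * (1 - var n) = sum_of_monoms {m. \<forall>i\<in>#m. Suc n \<le> i}"
  proof (rule mseries_eqI)
    fix m :: monom
    have "(\<forall>i\<in>#m. n \<le> i) \<longleftrightarrow> (\<forall>i\<in>#m - {#n#}. n \<le> i)" if "n \<in># m"
    proof -
      from that obtain k where "m = add_mset n k"
        by (auto dest: multi_member_split)
      thus ?thesis
        by simp
    qed
    moreover have "(\<forall>i\<in>#m. Suc n \<le> i) \<longleftrightarrow> (\<forall>i\<in>#m. n \<le> i) \<and> n \<notin># m"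
      by (auto simp: Suc_le_eq order_less_le)
    ultimately show "coeff (sum_of_monoms {m. \<forall>i\<in>#m. n \<le> i} * (1 - var n)) m =
        coeff (sum_of_monoms {m. \<forall>i\<in>#m. Suc n \<le> i}) m"
      by (auto simp: right_diff_distrib minus_mseries.rep_eq coeff_mult_monomial
          sum_of_monoms.rep_eq)
  qed
  thus ?case
    using Suc.IH by (simp flip: mult.assoc)
qed simp

text \<open>
  The coefficient of \<open>m\<close> is not affected by factors in variables that do not occur in \<open>m\<close>, so it
  can be read off from a finite partial product.
\<close>

lemma coeff_infinite_prod_one_minus_var:
  assumes "\<And>i. i \<in># m \<Longrightarrow> i < n"
  shows "coeff (infinite_prod (\<lambda>i. 1 - var i)) m = coeff (\<Prod>i<n. 1 - var i) m"
proof -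
  have stable: "coeff (\<Prod>i<k. 1 - var i) m = coeff (\<Prod>i<n. 1 - var i) m" if "n \<le> k" for k
    using that
  proof (induction k rule: dec_induct)
    case (step k)
    have "k \<notin># m"
      using assms step.hyps by force
    hence "coeff ((\<Prod>i<k. 1 - var i) * var k) m = 0"
      by (simp add: coeff_mult_monomial)
    with step.IH show ?case
      by (simp add: right_diff_distrib minus_mseries.rep_eq)
  qed simp
  have "(\<lambda>k. coeff (\<Prod>i<k. 1 - var i) m) \<longlonglongrightarrow> coeff (\<Prod>i<n. 1 - var i) m"
    by (intro tendsto_eventually eventually_sequentiallyI stable)
  thus ?thesis
    unfolding infinite_prod.rep_eq by (rule limI)
qed

lemma zeta_mult_infinite_prod:
  "sum_of_monoms UNIV * infinite_prod (\<lambda>i. 1 - var i) = 1"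
proof (rule mseries_eqI)
  fix m :: monom
  obtain n where n: "\<And>i. i \<in># m \<Longrightarrow> i < n"
    using finite_nat_set_iff_bounded[of "set_mset m"] by auto
  have "coeff (sum_of_monoms UNIV * infinite_prod (\<lambda>i. 1 - var i)) m
          = (\<Sum>d\<in>{d. d \<subseteq># m}. coeff (infinite_prod (\<lambda>i. 1 - var i)) d)"
    by (rule coeff_zeta_mult)
  also have "\<dots> = (\<Sum>d\<in>{d. d \<subseteq># m}. coeff (\<Prod>i<n. 1 - var i) d)"
    by (intro sum.cong refl coeff_infinite_prod_one_minus_var) (auto dest: n mset_subset_eqD)
  also have "\<dots> = coeff (sum_of_monoms {m. \<forall>i\<in>#m. n \<le> i}) m"
    by (simp flip: coeff_zeta_mult zeta_mult_finite_prod)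
  also have "\<dots> = coeff 1 m"
  proof -
    have "(\<forall>i\<in>#m. n \<le> i) \<longleftrightarrow> m = {#}"
      using n by (metis empty_iff leD multiset_nonemptyE set_mset_empty)
    thus ?thesis
      by (simp add: sum_of_monoms.rep_eq one_mseries.rep_eq)
  qed
  finally show "coeff (sum_of_monoms UNIV * infinite_prod (\<lambda>i. 1 - var i)) m = coeff 1 m" .
qed

text \<open>
  This is the form in which \<open>p_series\<close> gets determined: as \<open>\<zeta>\<close> is a unit, divisor sums characterize
  a series.
\<close>

lemma p_series_eqI:
  assumes "sum_of_monoms UNIV * f = sum_of_monoms (- I)"
  shows "p_series I = f"
proof -
  have "p_series I = sum_of_monoms UNIV * infinite_prod (\<lambda>i. 1 - var i) * f"
    unfolding p_series_def assms[symmetric] by (simp add: ac_simps)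
  thus ?thesis
    by (simp add: zeta_mult_infinite_prod)
qed


section \<open>The Moebius function and chains\<close>

lemma sum_moebius_interval:
  assumes "b \<in> P" "a \<subseteq># b"
  shows "(\<Sum>c\<in>{c\<in>P. a \<subseteq># c \<and> c \<subseteq># b}. moebius P a c) = (if a = b then 1 else 0)"
proof -
  have "{c\<in>P. a \<subseteq># c \<and> c \<subseteq># b} = insert b {c\<in>P. a \<subseteq># c \<and> c \<subset># b}"
    using assms by (auto simp: subset_mset.less_le)
  moreover have "finite {c\<in>P. a \<subseteq># c \<and> c \<subset># b}"
    by (rule finite_subset[OF _ finite_submultisets[of b]]) auto
  ultimately have "(\<Sum>c\<in>{c\<in>P. a \<subseteq># c \<and> c \<subseteq># b}. moebius P a c)
      = moebius P a b + (\<Sum>c\<in>{c\<in>P. a \<subseteq># c \<and> c \<subset># b}. moebius P a c)"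
    by simp
  moreover have "moebius P a b + (\<Sum>c\<in>{c\<in>P. a \<subseteq># c \<and> c \<subset># b}. moebius P a c)
      = (if a = b then 1 else 0)"
  proof (cases "a = b")
    case True
    hence "{c\<in>P. a \<subseteq># c \<and> c \<subset># b} = {}"
      by auto
    with True show ?thesis
      by (simp only: moebius_trivial_interval sum.empty) simp
  next
    case False
    with assms(2) have "a \<subset># b"
      by (simp add: subset_mset.less_le)
    with False show ?thesis
      by (simp add: moebius.simps[of P a b])
  qed
  ultimately show ?thesis
    by simp
qed

lemma finite_open_interval: "finite (open_interval P a b)"
  by (rule finite_subset[OF _ finite_submultisets[of b]]) (auto simp: open_interval_def)

lemma finite_order_complex: "finite (order_complex P a b)"
  by (rule finite_subset[of _ "Pow (open_interval P a b)"])
     (auto simp: order_complex_def finite_open_interval)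

text \<open>
  A nonempty finite chain is its greatest element, here one of maximal size, adjoined to a chain
  strictly below it.
\<close>

lemma order_complex_by_greatest:
  "order_complex P a b =
     insert {} (\<Union>c\<in>open_interval P a b. insert c ` order_complex P a c)" (is "_ = ?R")
proof (intro equalityI subsetI)
  fix C assume C: "C \<in> order_complex P a b"
  show "C \<in> ?R"
  proof (cases "C = {}")
    case False
    have sub: "C \<subseteq> open_interval P a b"
      using C by (simp add: order_complex_def)
    have fin: "finite C"
      using sub finite_open_interval by (rule finite_subset)
    obtain c where c: "c \<in> C" "\<And>d. d \<in> C \<Longrightarrow> size d \<le> size c"
      using obtains_MAX[OF fin False, of size] Max_ge[of "size ` C"] fin
      by (metis finite_imageI imageI)
    have below: "d \<subset># c" if "d \<in> C - {c}" for d
    proof -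
      have "d \<subseteq># c \<or> c \<subseteq># d"
        using C c(1) that by (auto simp: order_complex_def)
      moreover have "\<not> c \<subset># d"
        using c(2)[of d] that mset_subset_size[of c d] by auto
      ultimately show ?thesis
        using that by (auto simp: subset_mset.less_le)
    qed
    have "C - {c} \<in> order_complex P a c"
      using C sub below by (auto simp: order_complex_def open_interval_def)
    moreover have "C = insert c (C - {c})"
      using c(1) by auto
    ultimately show ?thesis
      using c(1) sub by blast
  qed simp
next
  fix C assume "C \<in> ?R"
  then consider "C = {}"
    | c D where "C = insert c D" "c \<in> open_interval P a b" "D \<in> order_complex P a c"
    by auto
  thus "C \<in> order_complex P a b"
  proof cases
    case 2
    have below: "d \<in> P \<and> a \<subset># d \<and> d \<subset># c" if "d \<in> D" for d
      using 2(3) that by (auto simp: order_complex_def open_interval_def)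
    have "C \<subseteq> open_interval P a b"
      using 2(1,2) below unfolding open_interval_def by (blast intro: subset_mset.less_trans)
    moreover have "x \<subseteq># y \<or> y \<subseteq># x" if "x \<in> C" "y \<in> C" for x y
      using that below 2(3) unfolding 2(1) order_complex_def
      by (blast intro: subset_mset.less_imp_le)
    ultimately show ?thesis
      by (simp add: order_complex_def)
  qed (simp add: order_complex_def)
qed

text \<open>
  The summand \<open>-1\<close> comes from the empty chain; removing the greatest element \<open>c\<close> of a nonempty
  chain changes the sign.
\<close>

lemma reduced_euler_char_recursion:
  "reduced_euler_char (order_complex P a b) =
     - 1 - (\<Sum>c\<in>open_interval P a b. reduced_euler_char (order_complex P a c))"
proof -
  let ?s = "\<lambda>F :: 'a multiset set. (-1 :: int) ^ (card F + 1)"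
  let ?B = "\<lambda>c. insert c ` order_complex P a c"
  have below: "d \<subset># c" if "C \<in> order_complex P a c" "d \<in> C" for C c d
    using that by (auto simp: order_complex_def open_interval_def)
  have disjoint: "?B c \<inter> ?B d = {}" if "c \<noteq> d" for c d
  proof (rule ccontr)
    assume "?B c \<inter> ?B d \<noteq> {}"
    then obtain C D where "C \<in> order_complex P a c" "D \<in> order_complex P a d"
        and "insert c C = insert d D"
      by auto
    with that have "c \<subset># d" "d \<subset># c"
      using below by (metis insertE insertI1)+
    thus False
      by auto
  qed
  have block: "sum ?s (?B c) = - reduced_euler_char (order_complex P a c)" for c
  proof -
    have notin: "c \<notin> C" if "C \<in> order_complex P a c" for C
      using below[OF that, of c] by auto
    have fin: "finite C" if "C \<in> order_complex P a c" for C
      using that finite_subset[OF _ finite_open_interval[of P a c]]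
      by (auto simp: order_complex_def)
    have "inj_on (insert c) (order_complex P a c)"
      by (rule inj_onI) (metis notin insert_ident)
    hence "sum ?s (?B c) = (\<Sum>C\<in>order_complex P a c. ?s (insert c C))"
      by (simp add: sum.reindex)
    also have "\<dots> = (\<Sum>C\<in>order_complex P a c. - ?s C)"
      by (rule sum.cong) (auto simp: notin fin)
    finally show ?thesis
      by (simp add: reduced_euler_char_def sum_negf)
  qed
  have "reduced_euler_char (order_complex P a b)
      = ?s {} + sum ?s (\<Union>c\<in>open_interval P a b. ?B c)"
    unfolding reduced_euler_char_def order_complex_by_greatest[of P a b]
    by (subst sum.insert) (auto simp: finite_open_interval finite_order_complex)
  also have "sum ?s (\<Union>c\<in>open_interval P a b. ?B c) = (\<Sum>c\<in>open_interval P a b. sum ?s (?B c))"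
    by (rule sum.UNION_disjoint)
       (use disjoint in \<open>auto simp: finite_open_interval finite_order_complex\<close>)
  finally show ?thesis
    by (simp only: block sum_negf card.empty) simp
qed

theorem philip_hall:
  assumes "a \<in> P" "a \<subset># b"
  shows "reduced_euler_char (order_complex P a b) = moebius P a b"
  using assms(2)
proof (induction "size b" arbitrary: b rule: less_induct)
  case less
  have split: "{c\<in>P. a \<subseteq># c \<and> c \<subset># b} = insert a (open_interval P a b)"
    using assms(1) less.prems by (auto simp: open_interval_def subset_mset.less_le)
  have "moebius P a b = - (\<Sum>c\<in>{c\<in>P. a \<subseteq># c \<and> c \<subset># b}. moebius P a c)"
    using less.prems by (auto simp: moebius.simps[of P a b])
  also have "\<dots> = - 1 - (\<Sum>c\<in>open_interval P a b. moebius P a c)"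
    unfolding split
    by (subst sum.insert)
       (use finite_open_interval[of P a b] in \<open>auto simp: open_interval_def moebius_trivial_interval\<close>)
  also have "(\<Sum>c\<in>open_interval P a b. moebius P a c)
      = (\<Sum>c\<in>open_interval P a b. reduced_euler_char (order_complex P a c))"
    by (rule sum.cong) (auto simp: open_interval_def less.hyps mset_subset_size)
  finally show ?case
    by (simp add: reduced_euler_char_recursion[of P a b])
qed


section \<open>Monoid ideals and the lcm lattice\<close>

text \<open>Divisibility is well-founded, so every monomial of \<open>I\<close> has a minimal divisor in \<open>I\<close>.\<close>

lemma mem_ideal_iff_min_gen_divides:
  assumes "monoid_ideal I"
  shows "m \<in> I \<longleftrightarrow> (\<exists>w\<in>min_gens I. w \<subseteq># m)"
proof
  show "m \<in> I \<Longrightarrow> \<exists>w\<in>min_gens I. w \<subseteq># m"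
  proof (induction "size m" arbitrary: m rule: less_induct)
    case less
    show ?case
    proof (cases "m \<in> min_gens I")
      case False
      with less.prems obtain a n where "m = a + n" "a \<noteq> {#}" "n \<in> I"
        by (auto simp: min_gens_def)
      with less.hyps[of n] show ?thesis
        by (metis mset_subset_eq_add_right nonempty_has_size size_union
            subset_mset.order_trans less_add_same_cancel2)
    qed auto
  qed
next
  assume "\<exists>w\<in>min_gens I. w \<subseteq># m"
  then obtain w where "w \<in> I" "w \<subseteq># m"
    by (auto simp: min_gens_def)
  hence "(m - w) + w \<in> I"
    using assms by (simp only: monoid_ideal_def)
  with \<open>w \<subseteq># m\<close> show "m \<in> I"
    by simp
qed

text \<open>
  The witness is the least common multiple of the generators that divide \<open>m\<close>. There may be
  infinitely many generators, but only finitely many divide \<open>m\<close>, so it does belong to the lattice.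
\<close>

lemma lcm_lattice_greatest_divisor:
  obtains r where "r \<in> lcm_lattice I" "r \<subseteq># m"
    and "\<And>d. d \<in> lcm_lattice I \<Longrightarrow> d \<subseteq># m \<Longrightarrow> d \<subseteq># r"
    and "\<And>w. w \<in> min_gens I \<Longrightarrow> w \<subseteq># m \<Longrightarrow> w \<subseteq># r"
proof
  let ?F = "{w \<in> min_gens I. w \<subseteq># m}"
  have fin: "finite ?F"
    by (rule finite_subset[OF _ finite_submultisets[of m]]) auto
  show "Sup ?F \<in> lcm_lattice I"
    using fin by (auto simp: lcm_lattice_def)
  show "Sup ?F \<subseteq># m"
    using fin by (rule Sup_finite_least_common_multiple(2)) auto
  show gen: "w \<subseteq># Sup ?F" if "w \<in> min_gens I" "w \<subseteq># m" for w
    using fin by (rule Sup_finite_least_common_multiple(1)) (use that in auto)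
  show "d \<subseteq># Sup ?F" if d: "d \<in> lcm_lattice I" "d \<subseteq># m" for d
  proof -
    from d(1) obtain G where G: "finite G" "G \<subseteq> min_gens I" "d = Sup G"
      by (auto simp: lcm_lattice_def)
    have "w \<subseteq># Sup ?F" if "w \<in> G" for w
      using G that d(2) Sup_finite_least_common_multiple(1)[OF G(1) that]
      by (intro gen) (auto intro: subset_mset.order_trans)
    thus ?thesis
      unfolding G(3) by (rule Sup_finite_least_common_multiple(2)[OF G(1)])
  qed
qed

lemma proper_ideal_iff:
  assumes "monoid_ideal I"
  shows "I \<noteq> UNIV \<longleftrightarrow> {#} \<notin> I"
  using assms unfolding monoid_ideal_def by (metis UNIV_I UNIV_eq_I add.right_neutral)

text \<open>
  Properness is essential: for the improper ideal the left-hand side is \<open>1\<close> for every \<open>m\<close>, although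
  \<open>m\<close> lies in the ideal.
\<close>

lemma sum_moebius_lcm_lattice:
  assumes "monoid_ideal I" "I \<noteq> UNIV"
  shows "(\<Sum>d\<in>{d \<in> lcm_lattice I. d \<subseteq># m}. moebius (lcm_lattice I) {#} d)
           = (if m \<in> I then 0 else 1)"
proof -
  obtain r where r: "r \<in> lcm_lattice I" "r \<subseteq># m"
      "\<And>d. d \<in> lcm_lattice I \<Longrightarrow> d \<subseteq># m \<Longrightarrow> d \<subseteq># r"
      "\<And>w. w \<in> min_gens I \<Longrightarrow> w \<subseteq># m \<Longrightarrow> w \<subseteq># r"
    using lcm_lattice_greatest_divisor by blast
  have "{d \<in> lcm_lattice I. d \<subseteq># m} = {d \<in> lcm_lattice I. {#} \<subseteq># d \<and> d \<subseteq># r}"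
    using r(2,3) by (auto intro: subset_mset.order_trans)
  hence "(\<Sum>d\<in>{d \<in> lcm_lattice I. d \<subseteq># m}. moebius (lcm_lattice I) {#} d)
      = (if {#} = r then 1 else 0)"
    using sum_moebius_interval[OF r(1), of "{#}"] by simp
  moreover have "{#} = r \<longleftrightarrow> m \<notin> I"
  proof
    assume "{#} = r"
    moreover have "{#} \<notin> min_gens I"
      using assms proper_ideal_iff by (auto simp: min_gens_def)
    ultimately show "m \<notin> I"
      using r(4) mem_ideal_iff_min_gen_divides[OF assms(1)] by fastforce
  next
    assume "m \<notin> I"
    hence "\<not> w \<subseteq># m" if "w \<in> min_gens I" for w
      using that mem_ideal_iff_min_gen_divides[OF assms(1)] by blast
    moreover obtain G where G: "finite G" "G \<subseteq> min_gens I" "r = Sup G"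
      using r(1) by (auto simp: lcm_lattice_def)
    ultimately have "G = {}"
      using r(2) Sup_finite_least_common_multiple(1)[OF G(1)]
      by (metis ex_in_conv subsetD subset_mset.order_trans)
    thus "{#} = r"
      using G(3) by (simp add: Sup_multiset_empty)
  qed
  ultimately show ?thesis
    by simp
qed


section \<open>The coefficients of the series of an ideal\<close>

lemma coeff_p_series:
  assumes "monoid_ideal I" "I \<noteq> UNIV"
  shows "coeff (p_series I) m
           = (if m \<in> lcm_lattice I then moebius (lcm_lattice I) {#} m else 0)"
proof -
  let ?c = "\<lambda>d. if d \<in> lcm_lattice I then moebius (lcm_lattice I) {#} d else 0"
  let ?f = "Abs_mseries ?c"
  have coeff_f: "coeff ?f d = ?c d" for d
    by (simp add: Abs_mseries_inverse)
  have "sum_of_monoms UNIV * ?f = sum_of_monoms (- I)"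
  proof (rule mseries_eqI)
    fix n
    have "coeff (sum_of_monoms UNIV * ?f) n = (\<Sum>d\<in>{d. d \<subseteq># n}. ?c d)"
      by (simp only: coeff_zeta_mult coeff_f)
    also have "\<dots> = (\<Sum>d\<in>{d \<in> lcm_lattice I. d \<subseteq># n}. moebius (lcm_lattice I) {#} d)"
      by (rule sum.mono_neutral_cong_right) (auto simp: finite_submultisets)
    finally show "coeff (sum_of_monoms UNIV * ?f) n = coeff (sum_of_monoms (- I)) n"
      by (simp add: sum_moebius_lcm_lattice[OF assms] sum_of_monoms.rep_eq)
  qed
  hence "p_series I = ?f"
    by (rule p_series_eqI)
  thus ?thesis
    by (simp only: coeff_f)
qed

text \<open>
  For the improper ideal the only minimal generator is \<open>{#}\<close>, so that all monomials other than \<open>{#}\<close> lie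
  outside the lattice, where the vanishing of the series is what has to be shown.
\<close>

lemma lcm_lattice_UNIV: "lcm_lattice UNIV = {{#}}"
proof -
  have gens: "min_gens UNIV \<subseteq> {{#}}"
    by (auto simp: min_gens_def) (metis add.right_neutral)
  have "m = {#}" if "m \<in> lcm_lattice UNIV" for m
  proof -
    from that obtain F where "finite F" "F \<subseteq> min_gens UNIV" "m = Sup F"
      by (auto simp: lcm_lattice_def)
    hence "m \<subseteq># {#}"
      using gens by (auto intro!: Sup_finite_least_common_multiple(2) simp del: subset_mset.le_zero_eq)
    thus ?thesis
      by simp
  qed
  thus ?thesis
    using lcm_lattice_least(1) by blast
qed

theorem theorem4p8:
  fixes I :: "monom set" and m :: monom
  assumes "monoid_ideal I"
  shows "(m \<notin> lcm_lattice I \<longrightarrow> coeff (p_series I) m = 0) \<and>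
         (m \<in> lcm_lattice I \<and> m \<noteq> {#} \<longrightarrow>
            coeff (p_series I) m = reduced_euler_char (order_complex (lcm_lattice I) {#} m) \<and>
            reduced_euler_char (order_complex (lcm_lattice I) {#} m) = moebius (lcm_lattice I) {#} m) \<and>
         (m = {#} \<and> I \<noteq> UNIV \<longrightarrow> coeff (p_series I) m = moebius (lcm_lattice I) {#} m)"
proof (cases "I = UNIV")
  case True
  thus ?thesis
    by (simp add: lcm_lattice_UNIV p_series_UNIV zero_mseries.rep_eq)
next
  case False
  have "reduced_euler_char (order_complex (lcm_lattice I) {#} m) = moebius (lcm_lattice I) {#} m"
    if "m \<noteq> {#}"
    by (rule philip_hall) (use that lcm_lattice_least(1) in \<open>auto simp: subset_mset.less_le\<close>)
  thus ?thesis
    using coeff_p_series[OF assms False] lcm_lattice_least(1) by auto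
qed

end
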